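(* Let $R$ be a finite ring with $|\mathrm{Cent}(R)| = 6$. Then $|R : Z(R)| \in \{8, 12, 16\}$.
   Context: Rings are associative; no identity element is assumed. For $x \in R$, $C_R(x) = \{y \in R : xy = yx\}$, and $\mathrm{Cent}(R) = \{C_R(x) : x \in R\}$ is the set of all distinct centralizers of elements of $R$. A ring is called $n$-centralizer if $|\mathrm{Cent}(R)| = n$. $Z(R) = \{s \in R : rs = sr \text{ for all } r \in R\}$ is the center of $R$, and $|R : Z(R)|$ is the index of the additive subgroup $Z(R)$ in the additive group of $R$. *)

theory Defs imports Main begin

(* The type class ring is associative and does not postulate a unit element.
   The ring R of the paper is the whole type 'a. *)

definition centralizer :: "'a::ring \<Rightarrow> 'a set" where
  "centralizer x = {y. x * y = y * x}"

definition Cent :: "'a::ring set set" where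
  "Cent = range centralizer"

definition center :: "'a::ring set" where
  "center = {s. \<forall>r. r * s = s * r}"

(* Number of additive cosets x + H; only meant for additive subgroups H of finite index
   (card yields 0 if there are infinitely many cosets). *)
definition additive_index :: "'a::ab_group_add set \<Rightarrow> nat" where
  "additive_index H = card (range (\<lambda>x. (+) x ` H))"

end

theory Submission imports Defs begin

text \<open>
  Write \<open>Z\<close> for the center. Instead of the centralizers \<open>C(x)\<close> themselves, the argument uses the
  bicentralizers \<open>D(x) = C(C(x))\<close>. They are additive subgroups with \<open>x \<in> D(x) \<subseteq> C(x)\<close>, there are as
  many of them as there are centralizers, and they form a closure system on points: \<open>y \<in> D(x)\<close>
  implies \<open>D(y) \<subseteq> D(x)\<close>. With six centralizers, exactly five bicentralizers come from noncentral
  elements. All five lie strictly between \<open>Z\<close> and \<open>R\<close>, and the maximal ones cover \<open>R\<close>.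

  Upper bound on the index. If \<open>H\<close> is a maximal bicentralizer and \<open>y\<close> lies outside \<open>H\<close>, the coset
  \<open>y + H\<close> is covered by the other maximal ones, so \<open>|H|\<close> is at most the sum of the \<open>|J \<inter> H|\<close> over the
  maximal \<open>J \<noteq> H\<close> (\<open>card_le_of_coset_cover\<close>). Because only five bicentralizers are available, this sum
  is at most \<open>4|Z|\<close> (\<open>sum_card_Int_max_bicentralizers_le\<close>). Hence at most five subgroups of order at
  most \<open>4|Z|\<close>, all containing \<open>Z\<close>, cover \<open>R\<close>, and \<open>|R| \<le> |Z| + 5 * 3|Z| = 16|Z|\<close>.

  Exact value. If there is a chain \<open>Z \<subset> A \<subset> B \<subset> R\<close> of additive subgroups, the index is a product of
  three factors that are at least 2, and 8, 12 and 16 are the only such products up to 16. If there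
  is no such chain, any two of the five subgroups meet in \<open>Z\<close> and add up to \<open>R\<close>. Then they all have
  the same order \<open>a|Z|\<close>, the index is \<open>a\<^sup>2\<close>, and counting the elements of the partition of \<open>R\<close> gives
  \<open>a\<^sup>2 = 1 + 5(a - 1)\<close>, so that \<open>a = 4\<close> (\<open>index_of_no_chain\<close>).
\<close>

section \<open>Counting in finite additive groups\<close>

definition additive_subgroup :: "'a::ab_group_add set \<Rightarrow> bool" where
  "additive_subgroup A \<longleftrightarrow> 0 \<in> A \<and> (\<forall>x\<in>A. \<forall>y\<in>A. x - y \<in> A)"

lemma additive_subgroup_zero: "additive_subgroup A \<Longrightarrow> 0 \<in> A"
  by (simp add: additive_subgroup_def)

lemma additive_subgroup_diff:
  "additive_subgroup A \<Longrightarrow> x \<in> A \<Longrightarrow> y \<in> A \<Longrightarrow> x - y \<in> A"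
  by (simp add: additive_subgroup_def)

lemma additive_subgroup_add:
  assumes "additive_subgroup A" "x \<in> A" "y \<in> A"
  shows "x + y \<in> A"
proof -
  have "x - (0 - y) \<in> A"
    using assms by (intro additive_subgroup_diff additive_subgroup_zero)
  then show ?thesis by simp
qed

lemma additive_subgroup_add_left_iff:
  assumes "additive_subgroup A" "x \<in> A"
  shows "x + y \<in> A \<longleftrightarrow> y \<in> A"
  using additive_subgroup_add[OF assms] additive_subgroup_diff[OF assms(1) _ assms(2), of "x + y"]
  by auto

lemma additive_subgroup_add_right_iff:
  assumes "additive_subgroup A" "y \<in> A"
  shows "x + y \<in> A \<longleftrightarrow> x \<in> A"
  using additive_subgroup_add_left_iff[OF assms] by (simp add: add.commute)

lemma additive_subgroup_Int:
  "additive_subgroup A \<Longrightarrow> additive_subgroup B \<Longrightarrow> additive_subgroup (A \<inter> B)"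
  by (auto simp: additive_subgroup_def)

definition subgroup_sum :: "'a::ab_group_add set \<Rightarrow> 'a set \<Rightarrow> 'a set" where
  "subgroup_sum A B = (\<lambda>(a, b). a + b) ` (A \<times> B)"

lemma additive_subgroup_sum:
  assumes "additive_subgroup A" "additive_subgroup B"
  shows "additive_subgroup (subgroup_sum A B)"
  unfolding additive_subgroup_def
proof (intro conjI ballI)
  show "0 \<in> subgroup_sum A B"
    using assms[THEN additive_subgroup_zero] by (force simp: subgroup_sum_def)
next
  fix x y assume "x \<in> subgroup_sum A B" "y \<in> subgroup_sum A B"
  then obtain a b c d where "a \<in> A" "b \<in> B" "c \<in> A" "d \<in> B" "x = a + b" "y = c + d"
    by (auto simp: subgroup_sum_def)
  then have "x - y = (a - c) + (b - d)" "a - c \<in> A" "b - d \<in> B"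
    using assms by (auto intro: additive_subgroup_diff)
  then show "x - y \<in> subgroup_sum A B"
    unfolding subgroup_sum_def by force
qed

lemma subset_subgroup_sum:
  assumes "additive_subgroup A" "additive_subgroup B"
  shows "A \<subseteq> subgroup_sum A B" "B \<subseteq> subgroup_sum A B"
  using assms[THEN additive_subgroup_zero] unfolding subgroup_sum_def by force+

lemma card_constant_fibres:
  assumes "finite S" "\<And>x. x \<in> S \<Longrightarrow> card {y \<in> S. f y = f x} = k"
  shows "card S = card (f ` S) * k"
proof -
  have "card S = (\<Sum>y\<in>f ` S. card {x \<in> S. f x = y})"
    using sum.image_gen[OF assms(1), of "\<lambda>_. 1::nat" f] by simp
  also have "\<dots> = (\<Sum>y\<in>f ` S. k)"
    using assms(2) by (intro sum.cong) auto
  finally show ?thesis by simp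
qed

text \<open>
  Lagrange's theorem for a union \<open>S\<close> of cosets of \<open>H\<close>. Taking for \<open>S\<close> a larger subgroup gives the
  divisibility of orders; taking the whole group gives the index.
\<close>

lemma lagrange_additive:
  fixes H S :: "'a::ab_group_add set"
  assumes "finite S" and H: "additive_subgroup H"
    and inv: "\<And>x h. x \<in> S \<Longrightarrow> h \<in> H \<Longrightarrow> x + h \<in> S"
  shows "card S = card ((\<lambda>x. (+) x ` H) ` S) * card H"
proof (rule card_constant_fibres[OF assms(1)])
  fix x assume x: "x \<in> S"
  have "(+) y ` H = (+) x ` H \<longleftrightarrow> y \<in> (+) x ` H" for y
  proof
    assume "(+) y ` H = (+) x ` H"
    moreover have "y \<in> (+) y ` H"
      using additive_subgroup_zero[OF H] by force
    ultimately show "y \<in> (+) x ` H" by simp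
  next
    assume "y \<in> (+) x ` H"
    then obtain h where h: "h \<in> H" "y = x + h" by auto
    show "(+) y ` H = (+) x ` H"
    proof (intro equalityI subsetI)
      fix u assume "u \<in> (+) y ` H"
      then show "u \<in> (+) x ` H"
        using h additive_subgroup_add[OF H] by (auto simp: add.assoc)
    next
      fix u assume "u \<in> (+) x ` H"
      then obtain g where g: "g \<in> H" "u = x + g" by auto
      then have "u = y + (g - h)" "g - h \<in> H"
        using h additive_subgroup_diff[OF H] by auto
      then show "u \<in> (+) y ` H" by blast
    qed
  qed
  then have "{y \<in> S. (+) y ` H = (+) x ` H} = (+) x ` H"
    using inv[OF x] by auto
  then show "card {y \<in> S. (+) y ` H = (+) x ` H} = card H"
    by (simp add: card_image)
qed

lemma card_proper_subgroup:
  assumes "finite B" "additive_subgroup A" "additive_subgroup B" "A \<subset> B"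
  obtains k where "card B = k * card A" "k \<ge> 2"
proof -
  obtain k where k: "card B = k * card A"
    using lagrange_additive[OF assms(1,2)] additive_subgroup_add[OF assms(3)] assms(4)
    by (meson psubsetD)
  have "card A < card B"
    using assms by (simp add: psubset_card_mono)
  then have "k \<noteq> 0" "k \<noteq> 1" using k by auto
  then show thesis using that[OF k] by simp
qed

lemma card_subgroup_sum:
  fixes A B :: "'a::ab_group_add set"
  assumes "finite A" "finite B" and A: "additive_subgroup A" and B: "additive_subgroup B"
  shows "card A * card B = card (subgroup_sum A B) * card (A \<inter> B)"
proof -
  have "card (A \<times> B) = card ((\<lambda>(a, b). a + b) ` (A \<times> B)) * card (A \<inter> B)"
  proof (rule card_constant_fibres)
    fix p assume "p \<in> A \<times> B"
    then obtain a b where p: "p = (a, b)" "a \<in> A" "b \<in> B" by auto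
    \<comment> \<open>Two representations of the same sum differ by moving an element of \<open>A \<inter> B\<close> across.\<close>
    have "{q \<in> A \<times> B. (case q of (a, b) \<Rightarrow> a + b) = (case p of (a, b) \<Rightarrow> a + b)}
        = (\<lambda>t. (a + t, b - t)) ` (A \<inter> B)"
    proof (intro equalityI subsetI)
      fix q assume "q \<in> {q \<in> A \<times> B. (case q of (a, b) \<Rightarrow> a + b) = (case p of (a, b) \<Rightarrow> a + b)}"
      then obtain c d where q: "q = (c, d)" "c \<in> A" "d \<in> B" "c + d = a + b"
        using p by auto
      then have eq: "c - a = b - d" by (simp add: algebra_simps)
      then have "c - a \<in> A \<inter> B"
        using p q additive_subgroup_diff[OF A, of c a] additive_subgroup_diff[OF B, of b d] by simp
      moreover have "q = (a + (c - a), b - (c - a))"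
        using q(1,4) by (simp add: algebra_simps)
      ultimately show "q \<in> (\<lambda>t. (a + t, b - t)) ` (A \<inter> B)" by blast
    next
      fix q assume "q \<in> (\<lambda>t. (a + t, b - t)) ` (A \<inter> B)"
      then show "q \<in> {q \<in> A \<times> B. (case q of (a, b) \<Rightarrow> a + b) = (case p of (a, b) \<Rightarrow> a + b)}"
        using p additive_subgroup_add[OF A] additive_subgroup_diff[OF B] by auto
    qed
    moreover have "inj_on (\<lambda>t. (a + t, b - t)) (A \<inter> B)"
      by (auto simp: inj_on_def)
    ultimately show "card {q \<in> A \<times> B. (case q of (a, b) \<Rightarrow> a + b) = (case p of (a, b) \<Rightarrow> a + b)}
        = card (A \<inter> B)"
      by (simp add: card_image)
  qed (use assms in auto)
  then show ?thesis by (simp add: subgroup_sum_def card_cartesian_product)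
qed

text \<open>
  The inequality behind every upper bound on a subgroup below: a subgroup \<open>J\<close> meets the coset \<open>y + K\<close>
  either not at all or in a coset of \<open>J \<inter> K\<close>.
\<close>

lemma card_le_of_coset_cover:
  fixes K :: "'a::ab_group_add set"
  assumes "finite K" and K: "additive_subgroup K" and "finite F"
    and F: "\<And>J. J \<in> F \<Longrightarrow> additive_subgroup J"
    and cover: "\<And>k. k \<in> K \<Longrightarrow> y + k \<in> \<Union>F"
  shows "card K \<le> (\<Sum>J\<in>F. card (J \<inter> K))"
proof -
  have "card {k \<in> K. y + k \<in> J} \<le> card (J \<inter> K)" if "J \<in> F" for J
  proof (cases "{k \<in> K. y + k \<in> J} = {}")
    case True
    show ?thesis unfolding True by simp
  next
    case False
    then obtain k0 where k0: "k0 \<in> K" "y + k0 \<in> J" by auto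
    have "(\<lambda>k. k - k0) ` {k \<in> K. y + k \<in> J} \<subseteq> J \<inter> K"
    proof (clarify, intro IntI)
      fix k assume k: "k \<in> K" "y + k \<in> J"
      show "k - k0 \<in> J"
        using additive_subgroup_diff[OF F[OF that] k(2) k0(2)] by simp
      show "k - k0 \<in> K"
        using additive_subgroup_diff[OF K k(1) k0(1)] .
    qed
    then have "card ((\<lambda>k. k - k0) ` {k \<in> K. y + k \<in> J}) \<le> card (J \<inter> K)"
      using assms(1) by (intro card_mono) auto
    then show ?thesis by (simp add: card_image inj_on_def)
  qed
  moreover have "K = (\<Union>J\<in>F. {k \<in> K. y + k \<in> J})"
    using cover by auto
  then have "card K \<le> (\<Sum>J\<in>F. card {k \<in> K. y + k \<in> J})"
    using card_UN_le[OF assms(3), of "\<lambda>J. {k \<in> K. y + k \<in> J}"] by simp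
  ultimately show ?thesis
    by (meson order_trans sum_mono)
qed

section \<open>Bicentralizers\<close>

lemma center_eq_centralizer_UNIV: "x \<in> center \<longleftrightarrow> centralizer x = UNIV"
  unfolding center_def centralizer_def set_eq_iff by (simp add: eq_commute[of "_ * x" "x * _"])

lemma centralizer_commute: "x \<in> centralizer y \<longleftrightarrow> y \<in> centralizer x"
  by (auto simp: centralizer_def)

text \<open>
  This is the double centralizer \<open>C(C(x))\<close>: the elements that commute with everything that
  commutes with \<open>x\<close>.
\<close>

definition bicentralizer :: "'a::ring \<Rightarrow> 'a set" where
  "bicentralizer x = {y. centralizer x \<subseteq> centralizer y}"

lemma additive_subgroup_bicentralizer: "additive_subgroup (bicentralizer (x::'a::ring))"
  unfolding additive_subgroup_def bicentralizer_def
  by (auto simp: centralizer_def subset_iff algebra_simps)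

lemma additive_subgroup_center: "additive_subgroup (center :: 'a::ring set)"
  by (auto simp: additive_subgroup_def center_def algebra_simps)

lemma bicentralizer_self: "x \<in> bicentralizer x"
  by (simp add: bicentralizer_def)

lemma bicentralizer_subset_iff: "bicentralizer y \<subseteq> bicentralizer x \<longleftrightarrow> y \<in> bicentralizer x"
  by (auto simp: bicentralizer_def)

lemma bicentralizer_eq_iff: "bicentralizer x = bicentralizer y \<longleftrightarrow> centralizer x = centralizer y"
  by (auto simp: bicentralizer_def)

lemma bicentralizer_subset_centralizer: "bicentralizer x \<subseteq> centralizer x"
proof
  fix y assume "y \<in> bicentralizer x"
  moreover have "x \<in> centralizer x" by (simp add: centralizer_def)
  ultimately have "x \<in> centralizer y" by (auto simp: bicentralizer_def)
  then show "y \<in> centralizer x" by (simp add: centralizer_commute)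
qed

lemma center_subset_bicentralizer: "center \<subseteq> bicentralizer x"
  by (auto simp: bicentralizer_def center_eq_centralizer_UNIV)

text \<open>
  Central elements are excluded because their bicentralizer is the center, the bottom element
  against which the others are measured.
\<close>

definition bicentralizers :: "'a::ring set set" where
  "bicentralizers = bicentralizer ` (- center)"

lemma bicentralizersE:
  assumes "A \<in> bicentralizers"
  obtains x where "x \<notin> center" "A = bicentralizer x"
  using assms by (auto simp: bicentralizers_def)

lemma bicentralizers_subgroup: "A \<in> bicentralizers \<Longrightarrow> additive_subgroup A"
  by (auto simp: bicentralizers_def additive_subgroup_bicentralizer)

lemma center_psubset_bicentralizers: "(A :: 'a::ring set) \<in> bicentralizers \<Longrightarrow> center \<subset> A"
proof (elim bicentralizersE)
  fix x :: 'a assume "x \<notin> center" "A = bicentralizer x"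
  then show "center \<subset> A"
    using center_subset_bicentralizer[of x] bicentralizer_self[of x] by blast
qed

lemma bicentralizers_psubset_UNIV: "(A :: 'a::ring set) \<in> bicentralizers \<Longrightarrow> A \<subset> UNIV"
proof (elim bicentralizersE)
  fix x :: 'a assume "x \<notin> center" "A = bicentralizer x"
  then show "A \<subset> UNIV"
    using bicentralizer_subset_centralizer[of x] center_eq_centralizer_UNIV[of x] by blast
qed

lemma bicentralizer_subset_bicentralizers:
  "A \<in> bicentralizers \<Longrightarrow> y \<in> A \<Longrightarrow> bicentralizer y \<subseteq> A"
  by (auto simp: bicentralizers_def bicentralizer_subset_iff[symmetric])

lemma bicentralizer_in_bicentralizers: "x \<notin> center \<Longrightarrow> bicentralizer x \<in> bicentralizers"
  by (auto simp: bicentralizers_def)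

text \<open>
  Centralizer and bicentralizer determine each other, so the noncentral elements produce equally
  many of both; the remaining centralizer is the whole ring, coming from the central elements.
\<close>

lemma card_bicentralizers:
  assumes "finite (Cent :: 'a::ring set set)"
  shows "card (Cent :: 'a::ring set set) = Suc (card (bicentralizers :: 'a set set))"
proof -
  have 0: "centralizer (0::'a) = UNIV" by (simp add: centralizer_def)
  have "(Cent :: 'a set set) = insert UNIV (centralizer ` (- center))"
    unfolding Cent_def
    using 0 by (auto simp: center_eq_centralizer_UNIV intro: rev_image_eqI)
  moreover have "UNIV \<notin> centralizer ` (- center :: 'a set)"
    by (auto simp: center_eq_centralizer_UNIV)
  moreover from calculation assms have "finite (centralizer ` (- center :: 'a set))"
    by (metis finite_insert)
  ultimately have "card (Cent :: 'a set set) = Suc (card (centralizer ` (- center :: 'a set)))"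
    by (metis card_insert_disjoint)
  also have "card (centralizer ` (- center :: 'a set)) = card (bicentralizers :: 'a set set)"
  proof (rule bij_betw_same_card[of "\<lambda>C. {y. C \<subseteq> centralizer y}"])
    show "bij_betw (\<lambda>C. {y. C \<subseteq> centralizer y}) (centralizer ` (- center :: 'a set)) bicentralizers"
      unfolding bij_betw_def bicentralizers_def
    proof
      show "inj_on (\<lambda>C. {y. C \<subseteq> centralizer y}) (centralizer ` (- center :: 'a set))"
        using bicentralizer_eq_iff by (auto simp: inj_on_def bicentralizer_def)
    qed (auto simp: bicentralizer_def image_image)
  qed
  finally show ?thesis .
qed

section \<open>Maximal bicentralizers\<close>

definition max_bicentralizers :: "'a::ring set set" where
  "max_bicentralizers = {A \<in> bicentralizers. \<forall>B\<in>bicentralizers. A \<subseteq> B \<longrightarrow> A = B}"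

lemma max_bicentralizers_subset: "max_bicentralizers \<subseteq> bicentralizers"
  by (auto simp: max_bicentralizers_def)

lemma max_bicentralizers_maximal:
  "A \<in> max_bicentralizers \<Longrightarrow> B \<in> bicentralizers \<Longrightarrow> A \<subseteq> B \<Longrightarrow> A = B"
  by (auto simp: max_bicentralizers_def)

lemma max_bicentralizers_cover:
  fixes x :: "'a::{ring,finite}"
  assumes "x \<notin> center"
  obtains A where "A \<in> max_bicentralizers" "x \<in> A"
proof -
  obtain A where A: "A \<in> bicentralizers" "bicentralizer x \<subseteq> A"
    "\<forall>B\<in>bicentralizers. A \<subseteq> B \<longrightarrow> A = B"
    using finite_has_maximal2[OF _ bicentralizer_in_bicentralizers[OF assms]] by auto
  then show thesis
    using that[of A] bicentralizer_self[of x] by (auto simp: max_bicentralizers_def)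
qed

text \<open>
  This makes the cover by maximal bicentralizers irredundant: by closure, a bicentralizer that
  contains a generator of \<open>A\<close> contains all of \<open>A\<close>.
\<close>

lemma max_bicentralizers_generator:
  assumes "A \<in> max_bicentralizers"
  obtains x where "x \<in> A" "x \<notin> center"
    "\<And>B. B \<in> bicentralizers \<Longrightarrow> x \<in> B \<Longrightarrow> B = A"
proof -
  obtain x where x: "x \<notin> center" "A = bicentralizer x"
    using assms max_bicentralizers_subset by (blast elim: bicentralizersE)
  have "B = A" if "B \<in> bicentralizers" "x \<in> B" for B
    using bicentralizer_subset_bicentralizers[OF that] max_bicentralizers_maximal[OF assms that(1)] x
    by simp
  then show thesis using that x bicentralizer_self by blast
qed

text \<open>
  If \<open>x\<close> lies in the maximal bicentralizer \<open>D(g)\<close>, then \<open>x \<in> C(g)\<close>, and \<open>y \<in> D(g)\<close> commutes with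
  everything in \<open>C(g)\<close>, in particular with \<open>x\<close>. Every \<open>x\<close> outside the center is reached in this way.
\<close>

lemma Inter_max_bicentralizers:
  fixes y :: "'a::{ring,finite}"
  assumes "\<And>A. A \<in> max_bicentralizers \<Longrightarrow> y \<in> A"
  shows "y \<in> center"
proof -
  have "x \<in> centralizer y" for x
  proof (cases "x \<in> center")
    case True
    then show ?thesis by (auto simp: center_def centralizer_def)
  next
    case False
    then obtain A where A: "A \<in> max_bicentralizers" "x \<in> A"
      by (rule max_bicentralizers_cover)
    then obtain g where g: "A = bicentralizer g"
      using max_bicentralizers_subset by (blast elim: bicentralizersE)
    have "x \<in> centralizer g"
      using A(2) g bicentralizer_subset_centralizer by blast
    moreover have "centralizer g \<subseteq> centralizer y"
      using assms[OF A(1)] g by (simp add: bicentralizer_def)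
    ultimately show ?thesis by blast
  qed
  then show ?thesis by (auto simp: center_eq_centralizer_UNIV)
qed

text \<open>
  If \<open>H\<close> meets all other maximal bicentralizers only in the center, the sum has at most four terms,
  each at most \<open>|Z|\<close>. Otherwise some noncentral \<open>y\<close> lies in \<open>J1 \<inter> H\<close>, and \<open>W = D(y)\<close> is a
  bicentralizer that is not maximal. The irredundance of the cover then produces two more maximal
  ones, \<open>J2\<close> and \<open>J3\<close>, so that all five are \<open>H, J1, J2, J3, W\<close>. As \<open>W\<close> is the only one that is not
  maximal, \<open>J1 \<inter> H = W\<close>, whereas \<open>J2\<close> and \<open>J3\<close> meet \<open>H\<close> in the center. A coset of \<open>W\<close> outside
  \<open>H \<union> J1\<close> is covered by \<open>J2\<close> and \<open>J3\<close>, which bounds \<open>|W|\<close> by \<open>2|Z|\<close> and the sum by \<open>(2 + 1 + 1)|Z|\<close>.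
\<close>

lemma sum_card_Int_max_bicentralizers_le:
  fixes H :: "'a::{ring,finite} set"
  assumes five: "card (bicentralizers :: 'a set set) = 5" and H: "H \<in> max_bicentralizers"
  shows "(\<Sum>J\<in>max_bicentralizers - {H}. card (J \<inter> H)) \<le> 4 * card (center :: 'a set)"
proof (cases "\<exists>J\<in>max_bicentralizers - {H}. \<not> J \<inter> H \<subseteq> center")
  case False
  have "card (J \<inter> H) \<le> card (center :: 'a set)" if "J \<in> max_bicentralizers - {H}" for J
  proof (rule card_mono)
    show "J \<inter> H \<subseteq> center" using False that by blast
  qed simp
  then have "(\<Sum>J\<in>max_bicentralizers - {H}. card (J \<inter> H))
      \<le> card (max_bicentralizers - {H}) * card (center :: 'a set)"
    by (rule sum_bounded_above[where 'a = nat, simplified])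
  moreover have "card (max_bicentralizers - {H}) \<le> 4"
    using card_mono[OF _ max_bicentralizers_subset[where 'a = 'a]] five H
    by (simp add: card_Diff_singleton)
  ultimately show ?thesis
    by (meson mult_le_mono1 order_trans)
next
  case True
  then obtain J1 y where J1: "J1 \<in> max_bicentralizers" "J1 \<noteq> H"
    and y: "y \<in> J1" "y \<in> H" "y \<notin> center" by auto
  then obtain J2 where J2: "J2 \<in> max_bicentralizers" "y \<notin> J2"
    using Inter_max_bicentralizers by blast
  note bic = subsetD[OF max_bicentralizers_subset]
  note grp = bicentralizers_subgroup[OF bic]
  obtain x where x: "x \<in> J2" "x \<notin> center" "\<And>B. B \<in> bicentralizers \<Longrightarrow> x \<in> B \<Longrightarrow> B = J2"
    by (rule max_bicentralizers_generator[OF J2(1)]) blast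
  have x_notin: "x \<notin> H" "x \<notin> J1"
    using x(3) bic[OF H] bic[OF J1(1)] J2(2) y by blast+
  \<comment> \<open>\<open>y\<close> is in \<open>H\<close> and \<open>J1\<close> but \<open>x\<close> is not, and conversely for \<open>J2\<close>; so \<open>x + y\<close> needs a fourth
    subgroup to cover it.\<close>
  have xy: "x + y \<notin> H" "x + y \<notin> J1" "x + y \<notin> J2"
    using additive_subgroup_add_right_iff[OF grp[OF H] y(2), of x]
      additive_subgroup_add_right_iff[OF grp[OF J1(1)] y(1), of x]
      additive_subgroup_add_left_iff[OF grp[OF J2(1)] x(1), of y] x_notin J2(2) by auto
  then have "x + y \<notin> center"
    using center_psubset_bicentralizers[OF bic[OF H]] by blast
  then obtain J3 where J3: "J3 \<in> max_bicentralizers" "x + y \<in> J3"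
    by (rule max_bicentralizers_cover)
  have "y \<notin> J3"
    using J3(2) additive_subgroup_add_right_iff[OF grp[OF J3(1)], of y x] x(3)[OF bic[OF J3(1)]] J2(2)
    by auto
  define W where "W = bicentralizer y"
  have W: "W \<in> bicentralizers" "y \<in> W" "W \<subseteq> H" "W \<subseteq> J1"
    using y bicentralizer_in_bicentralizers bicentralizer_self
      bicentralizer_subset_bicentralizers[OF bic[OF H]]
      bicentralizer_subset_bicentralizers[OF bic[OF J1(1)]]
    by (auto simp: W_def)
  have W_nonmax: "W \<notin> max_bicentralizers"
    using max_bicentralizers_maximal[OF _ bic[OF H] W(3)]
      max_bicentralizers_maximal[OF _ bic[OF J1(1)] W(4)] J1(2) by blast
  have "distinct [H, J1, J2, J3, W]"
    using J1(2) J2(2) \<open>y \<notin> J3\<close> y W xy J3(2) W_nonmax H J1(1) J2(1) J3(1) by auto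
  then have "card {H, J1, J2, J3, W} = 5" by simp
  then have P: "bicentralizers = {H, J1, J2, J3, W}"
    using five bic[OF H] bic[OF J1(1)] bic[OF J2(1)] bic[OF J3(1)] W(1)
    by (intro card_subset_eq[symmetric]) auto
  then have M: "max_bicentralizers - {H} = {J1, J2, J3}"
  proof (intro equalityI)
    show "max_bicentralizers - {H} \<subseteq> {J1, J2, J3}"
      using bic P W_nonmax by blast
    show "{J1, J2, J3} \<subseteq> max_bicentralizers - {H}"
      using J1(1) J2(1) J3(1) \<open>distinct _\<close> by auto
  qed
  have Int_H: "bicentralizer u = W" if "u \<notin> center" "u \<in> J" "u \<in> H" "J \<in> max_bicentralizers" "J \<noteq> H" for u J
  proof -
    have sub: "bicentralizer u \<subseteq> J" "bicentralizer u \<subseteq> H"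
      using bicentralizer_subset_bicentralizers[OF bic[OF that(4)]]
        bicentralizer_subset_bicentralizers[OF bic[OF H]] that by auto
    have "bicentralizer u \<notin> max_bicentralizers"
      using max_bicentralizers_maximal[OF _ bic[OF H] sub(2)]
        max_bicentralizers_maximal[OF _ bic[OF that(4)] sub(1)] that(5) by blast
    moreover have "bicentralizer u \<in> {H, J1, J2, J3, W}"
      unfolding P[symmetric] by (rule bicentralizer_in_bicentralizers[OF that(1)])
    ultimately show ?thesis using H J1(1) J2(1) J3(1) by blast
  qed
  have Int_center: "J \<inter> H \<subseteq> center" if "J \<in> max_bicentralizers" "J \<noteq> H" "y \<notin> J" for J
  proof
    fix u assume u: "u \<in> J \<inter> H"
    show "u \<in> center"
    proof (rule ccontr)
      assume "u \<notin> center"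
      then have "W \<subseteq> J"
        using Int_H[of u J] u that bicentralizer_subset_bicentralizers[OF bic[OF that(1)], of u] by auto
      then show False using W(2) that(3) by blast
    qed
  qed
  have "J2 \<noteq> H" "J3 \<noteq> H" "J2 \<noteq> J3" "J1 \<noteq> J2" "J1 \<noteq> J3"
    using \<open>distinct _\<close> by auto
  have "J2 \<inter> H \<subseteq> center" "J3 \<inter> H \<subseteq> center"
    using Int_center J2 J3 \<open>J2 \<noteq> H\<close> \<open>J3 \<noteq> H\<close> \<open>y \<notin> J3\<close> by blast+
  then have small: "card (J2 \<inter> H) \<le> card (center :: 'a set)" "card (J3 \<inter> H) \<le> card (center :: 'a set)"
    by (auto intro: card_mono)
  have "center \<subseteq> W"
    using center_psubset_bicentralizers[OF W(1)] by blast
  then have "J1 \<inter> H \<subseteq> W"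
    using Int_H[OF _ _ _ J1] bicentralizer_self by blast
  then have "card (J1 \<inter> H) \<le> card W"
    by (simp add: card_mono)
  \<comment> \<open>The coset \<open>x + W\<close> avoids \<open>H\<close> and \<open>J1\<close>, since both contain \<open>W\<close> and neither contains \<open>x\<close>.\<close>
  also have "card W \<le> (\<Sum>J\<in>{J2, J3}. card (J \<inter> W))"
  proof (rule card_le_of_coset_cover[of _ _ x])
    fix k assume k: "k \<in> W"
    then have "x + k \<notin> H" "x + k \<notin> J1"
      using additive_subgroup_add_right_iff[OF grp[OF H], of k x]
        additive_subgroup_add_right_iff[OF grp[OF J1(1)], of k x] W(3,4) x_notin by auto
    moreover from this obtain J where "J \<in> max_bicentralizers" "x + k \<in> J"
      using max_bicentralizers_cover center_psubset_bicentralizers[OF bic[OF H]]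
      by (metis psubsetD)
    ultimately show "x + k \<in> \<Union>{J2, J3}"
      using M by auto
  qed (use grp J2(1) J3(1) bicentralizers_subgroup[OF W(1)] in auto)
  also have "\<dots> \<le> card (J2 \<inter> H) + card (J3 \<inter> H)"
    using \<open>J2 \<noteq> J3\<close> W(3) by (auto intro!: add_mono card_mono)
  finally have "card (J1 \<inter> H) \<le> card (J2 \<inter> H) + card (J3 \<inter> H)" .
  then show ?thesis
    using small M \<open>J2 \<noteq> J3\<close> \<open>J1 \<noteq> J2\<close> \<open>J1 \<noteq> J3\<close> by simp
qed

lemma card_max_bicentralizer_le:
  fixes H :: "'a::{ring,finite} set"
  assumes five: "card (bicentralizers :: 'a set set) = 5" and H: "H \<in> max_bicentralizers"
  shows "card H \<le> 4 * card (center :: 'a set)"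
proof -
  note bic = subsetD[OF max_bicentralizers_subset]
  note grp = bicentralizers_subgroup[OF bic]
  obtain y where y: "y \<notin> H"
    using bicentralizers_psubset_UNIV[OF bic[OF H]] by blast
  have "card H \<le> (\<Sum>J\<in>max_bicentralizers - {H}. card (J \<inter> H))"
  proof (rule card_le_of_coset_cover[of _ _ y])
    fix k assume "k \<in> H"
    then have "y + k \<notin> H"
      using additive_subgroup_add_right_iff[OF grp[OF H], of k y] y by simp
    moreover from this obtain J where "J \<in> max_bicentralizers" "y + k \<in> J"
      using max_bicentralizers_cover center_psubset_bicentralizers[OF bic[OF H]]
      by (metis psubsetD)
    ultimately show "y + k \<in> \<Union>(max_bicentralizers - {H})" by auto
  qed (use grp H in auto)
  with sum_card_Int_max_bicentralizers_le[OF assms] show ?thesis by simp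
qed

lemma card_ring_le:
  assumes five: "card (bicentralizers :: 'a::{ring,finite} set set) = 5"
  shows "card (UNIV :: 'a set) \<le> 16 * card (center :: 'a set)"
proof -
  let ?M = "max_bicentralizers :: 'a set set" and ?Z = "center :: 'a set"
  note bic = subsetD[OF max_bicentralizers_subset]
  have "(UNIV :: 'a set) = ?Z \<union> (\<Union>J\<in>?M. J - ?Z)"
  proof (intro equalityI subsetI)
    fix x :: 'a
    show "x \<in> ?Z \<union> (\<Union>J\<in>?M. J - ?Z)"
    proof (cases "x \<in> ?Z")
      case False
      then obtain J where "J \<in> ?M" "x \<in> J" by (rule max_bicentralizers_cover)
      with False show ?thesis by blast
    qed simp
  qed simp
  then have "card (UNIV :: 'a set) \<le> card ?Z + card (\<Union>J\<in>?M. J - ?Z)"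
    by (metis card_Un_le)
  also have "card (\<Union>J\<in>?M. J - ?Z) \<le> (\<Sum>J\<in>?M. card (J - ?Z))"
    by (rule card_UN_le) simp
  also have "\<dots> \<le> card ?M * (3 * card ?Z)"
  proof (rule sum_bounded_above[where 'a = nat, simplified])
    fix J assume J: "J \<in> ?M"
    have "card (J - ?Z) = card J - card ?Z"
      using center_psubset_bicentralizers[OF bic[OF J]] by (intro card_Diff_subset) auto
    then show "card (J - ?Z) \<le> 3 * card ?Z"
      using card_max_bicentralizer_le[OF five J] by simp
  qed
  also have "\<dots> \<le> 5 * (3 * card ?Z)"
    using card_mono[OF _ max_bicentralizers_subset[where 'a = 'a]] five by simp
  finally show ?thesis by simp
qed

section \<open>The index of the center\<close>

lemma card_eq_additive_index:
  assumes "additive_subgroup (H :: 'a::{ab_group_add,finite} set)"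
  shows "card (UNIV :: 'a set) = additive_index H * card H"
  unfolding additive_index_def by (rule lagrange_additive) (use assms in auto)

lemma product_three_le_16:
  fixes h k l :: nat
  assumes "h \<ge> 2" "k \<ge> 2" "l \<ge> 2" "h * k * l \<le> 16"
  shows "h * k * l \<in> {8, 12, 16}"
proof -
  have "h * (2 * 2) \<le> h * (k * l)" "k * (2 * 2) \<le> k * (h * l)" "l * (2 * 2) \<le> l * (h * k)"
    by (intro mult_le_mono order_refl assms)+
  moreover have "h * (k * l) = h * k * l" "k * (h * l) = h * k * l" "l * (h * k) = h * k * l"
    by (simp_all add: ac_simps)
  ultimately have "h \<le> 4" "k \<le> 4" "l \<le> 4"
    using assms(4) by presburger+
  then have "h \<in> {2,3,4}" "k \<in> {2,3,4}" "l \<in> {2,3,4}"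
    using assms by auto
  then show ?thesis using assms(4) by auto
qed

lemma index_of_chain:
  fixes A B Z :: "'a::{ab_group_add,finite} set"
  assumes "additive_subgroup Z" "additive_subgroup A" "additive_subgroup B"
    and "Z \<subset> A" "A \<subset> B" "B \<subset> UNIV" and le: "card (UNIV :: 'a set) \<le> 16 * card Z"
  shows "additive_index Z \<in> {8, 12, 16}"
proof -
  obtain h where h: "card A = h * card Z" "h \<ge> 2"
    using card_proper_subgroup[of A Z] assms by auto
  obtain k where k: "card B = k * card A" "k \<ge> 2"
    using card_proper_subgroup[of B A] assms by auto
  obtain l where l: "card (UNIV :: 'a set) = l * card B" "l \<ge> 2"
    using card_proper_subgroup[of "UNIV :: 'a set" B] assms by (auto simp: additive_subgroup_def)
  have ne: "Z \<noteq> {}"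
    using additive_subgroup_zero[OF assms(1)] by blast
  have "additive_index Z * card Z = card (UNIV :: 'a set)"
    by (rule card_eq_additive_index[OF assms(1), symmetric])
  also have "\<dots> = l * (k * (h * card Z))"
    using h k l by simp
  also have "\<dots> = (h * k * l) * card Z"
    by (simp only: ac_simps)
  finally have index: "additive_index Z = h * k * l"
    using ne by (metis card_0_eq finite mult_cancel2)
  moreover have "h * k * l \<le> 16"
    unfolding index[symmetric] using le card_eq_additive_index[OF assms(1)] ne by (simp add: card_gt_0_iff)
  ultimately show ?thesis
    using product_three_le_16[OF h(2) k(2) l(2)] by simp
qed

text \<open>
  Without intermediate chains the five bicentralizers are pairwise complementary modulo the center,
  like the five lines through the origin of the affine plane over the field with four elements.
\<close>

lemma index_of_no_chain:
  assumes five: "card (bicentralizers :: 'a::{ring,finite} set set) = 5"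
    and no_chain: "\<And>A B :: 'a set. additive_subgroup A \<Longrightarrow> additive_subgroup B \<Longrightarrow>
        center \<subset> A \<Longrightarrow> A \<subset> B \<Longrightarrow> B = UNIV"
  shows "additive_index (center :: 'a set) = 16"
proof -
  let ?P = "bicentralizers :: 'a set set" and ?Z = "center :: 'a set"
  let ?N = "card (UNIV :: 'a set)"
  have no_sub: "\<not> A \<subset> B" if "A \<in> ?P" "B \<in> ?P" for A B
    using no_chain[of A B] that bicentralizers_subgroup center_psubset_bicentralizers
      bicentralizers_psubset_UNIV by blast
  have Int: "A \<inter> B = ?Z" if "A \<in> ?P" "B \<in> ?P" "A \<noteq> B" for A B
  proof (rule ccontr)
    assume "A \<inter> B \<noteq> ?Z"
    then have "?Z \<subset> A \<inter> B"
      using center_psubset_bicentralizers that by blast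
    moreover have "A \<inter> B \<subset> A"
      using no_sub that by blast
    ultimately show False
      using no_chain[of "A \<inter> B" A] additive_subgroup_Int bicentralizers_subgroup
        bicentralizers_psubset_UNIV that by blast
  qed
  have prod: "card A * card B = ?N * card ?Z" if "A \<in> ?P" "B \<in> ?P" "A \<noteq> B" for A B
  proof -
    have grp: "additive_subgroup A" "additive_subgroup B"
      using that bicentralizers_subgroup by auto
    have "\<not> B \<subseteq> A" using no_sub that by blast
    then have "A \<subset> subgroup_sum A B"
      using subset_subgroup_sum[OF grp] by blast
    then have "subgroup_sum A B = UNIV"
      using no_chain additive_subgroup_sum[OF grp] grp that(1) center_psubset_bicentralizers by blast
    then show ?thesis
      using card_subgroup_sum[OF _ _ grp] Int[OF that] by simp
  qed
  have ne: "?Z \<noteq> {}"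
    using additive_subgroup_zero[OF additive_subgroup_center] by blast
  have "?P \<noteq> {}" using five by auto
  then obtain A where A: "A \<in> ?P" by blast
  \<comment> \<open>Compare \<open>A\<close> and \<open>B\<close> through a third bicentralizer that is complementary to both.\<close>
  have same: "card B = card A" if B: "B \<in> ?P" for B
  proof (cases "B = A")
    case False
    have "card (?P - {A, B}) \<ge> 3"
      using five card_Diff_subset[of "{A, B}" ?P] A B False by simp
    then obtain C where C: "C \<in> ?P" "C \<noteq> A" "C \<noteq> B"
      by (metis Diff_iff all_not_in_conv card.empty insert_iff not_numeral_le_zero)
    have "C \<noteq> {}"
      using additive_subgroup_zero[OF bicentralizers_subgroup[OF C(1)]] by blast
    moreover have "card A * card C = card B * card C"
      using prod A B C by metis
    ultimately show ?thesis by simp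
  qed simp
  obtain a where a: "card A = a * card ?Z" "a \<ge> 2"
    using card_proper_subgroup[of A ?Z] additive_subgroup_center bicentralizers_subgroup[OF A]
      center_psubset_bicentralizers[OF A] by auto
  have "card (?P - {A}) = 4" using five A by simp
  then have "?P - {A} \<noteq> {}" by (metis card.empty zero_neq_numeral)
  then obtain B where B: "B \<in> ?P" "B \<noteq> A" by auto
  have N: "?N = a * a * card ?Z"
    using prod[OF A B(1)] same[OF B(1)] B(2) a ne by simp
  have "(UNIV :: 'a set) = ?Z \<union> (\<Union>J\<in>?P. J - ?Z)"
  proof (intro equalityI subsetI)
    fix x :: 'a
    show "x \<in> ?Z \<union> (\<Union>J\<in>?P. J - ?Z)"
      using bicentralizer_self[of x] bicentralizer_in_bicentralizers[of x]
      by (cases "x \<in> ?Z") blast+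
  qed simp
  then have "?N = card (?Z \<union> (\<Union>J\<in>?P. J - ?Z))" by simp
  also have "\<dots> = card ?Z + card (\<Union>J\<in>?P. J - ?Z)"
    by (rule card_Un_disjoint) auto
  also have "card (\<Union>J\<in>?P. J - ?Z) = (\<Sum>J\<in>?P. card (J - ?Z))"
    using Int by (intro card_UN_disjoint) auto
  also have "\<dots> = (\<Sum>J\<in>?P. (a - 1) * card ?Z)"
  proof (rule sum.cong[OF refl])
    fix J assume J: "J \<in> ?P"
    have "card (J - ?Z) = card J - card ?Z"
      using center_psubset_bicentralizers[OF J] by (intro card_Diff_subset) auto
    then show "card (J - ?Z) = (a - 1) * card ?Z"
      using same[OF J] a by (simp add: diff_mult_distrib)
  qed
  finally have "a * a * card ?Z = (1 + 5 * (a - 1)) * card ?Z"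
    using N five by simp
  then have "a * a = 1 + 5 * (a - 1)"
    using ne by (metis card_0_eq finite mult_cancel2)
  \<comment> \<open>The equation reads \<open>(a - 1)(a - 4) = 0\<close>; it is solved for \<open>b = a - 2\<close> to avoid truncated
    subtraction.\<close>
  moreover obtain b where b: "a = b + 2" using a(2) by (metis add.commute le_Suc_ex)
  ultimately have eq: "b * b = b + 2"
    by (simp add: algebra_simps)
  have "b \<le> 2"
  proof (rule ccontr)
    assume "\<not> b \<le> 2"
    then have "3 * b \<le> b * b" by (intro mult_le_mono1) simp
    with eq \<open>\<not> b \<le> 2\<close> show False by simp
  qed
  then have "b \<in> {0, 1, 2}" by auto
  with eq b have "a = 4" by auto
  then have "additive_index ?Z * card ?Z = 16 * card ?Z"
    unfolding card_eq_additive_index[OF additive_subgroup_center, symmetric] N by simp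
  with ne show ?thesis by (metis card_0_eq finite mult_cancel2)
qed

theorem theorem3p1:
  assumes "card (Cent :: 'a::{ring,finite} set set) = 6"
  shows "additive_index (center :: 'a set) \<in> {8, 12, 16}"
proof -
  have five: "card (bicentralizers :: 'a set set) = 5"
    using card_bicentralizers[where 'a = 'a] assms by simp
  show ?thesis
  proof (cases "\<exists>A B :: 'a set. additive_subgroup A \<and> additive_subgroup B \<and>
      center \<subset> A \<and> A \<subset> B \<and> B \<noteq> UNIV")
    case True
    then show ?thesis
      using index_of_chain[OF additive_subgroup_center] card_ring_le[OF five] by blast
  next
    case False
    then show ?thesis
      using index_of_no_chain[OF five] by blast
  qed
qed

end
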